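(* Consider the Gibbs sampler defined in the context, with $K\ge3$ and $m_i\ge2$ for all $i$. Let $a_1>3/2$, $c_3\in(0,\min\{b_1,b_2\})$, $\delta_1=\frac1{2a_1+K-2}$, $\delta_7=\frac1{2(a_1-1)}$, and let $d>0$ satisfy $d\log d>(c_3\delta_7)/(K\delta_1)$. Put $$c_4=\frac{\delta_7}{K\delta_1d},\qquad c_l=\bar y-\sqrt{(m_0-\bar y)^2+d},\qquad c_u=\bar y+\sqrt{(m_0-\bar y)^2+d},$$ and $C_G=C_{G_1}\cap C_{G_2}\cap C_{G_3}$, where $$C_{G_1}=\left\{(\theta,\lambda):c_4\le\lambda_\theta\le\frac{\log d}{c_3}\right\},\quad C_{G_2}=\left\{(\theta,\lambda):0<\lambda_e\le\frac{\log d}{c_3}\right\},\quad C_{G_3}=\left\{(\theta,\lambda):c_l\le\frac{s_0m_0+K\lambda_\theta\bar\theta}{s_0+K\lambda_\theta}\le c_u\right\}.$$ Let $q(\mu,\theta,\lambda)$ be the density on $\mathbb{R}\times\mathbb{R}^K\times\mathbb{R}_+^2$ defined by $$q(\mu,\theta,\lambda)=\left[\frac{g_1(\mu,\theta)g_2(\mu)}{\int_{\mathbb{R}}\int_{\mathbb{R}^K}g_1(\mu,\theta)g_2(\mu)\,d\theta\,d\mu}\right]f(\lambda\mid\mu,\theta,y),$$ where $$g_1(\mu,\theta)=\left(\frac{c_4}{2\pi}\right)^{K/2}\exp\left\{-\frac{\log d}{2c_3}\sum_{i=1}^K\left[(\theta_i-\mu)^2+m_i(\theta_i-\bar y_i)^2\right]\right\}$$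 and $$g_2(\mu)=\begin{cases}\mathrm{N}\left(c_u,[s_0+K\log(d)/c_3]^{-1};\mu\right),&\mu\le\bar y,\\ \mathrm{N}\left(c_l,[s_0+K\log(d)/c_3]^{-1};\mu\right),&\mu>\bar y.\end{cases}$$ Set $$\varepsilon_G=\left[\frac{s_0+Kc_4}{s_0+K\log(d)/c_3}\right]^{1/2}\left[\int_{\mathbb{R}}\int_{\mathbb{R}^K}g_1(\mu,\theta)g_2(\mu)\,d\theta\,d\mu\right].$$ Then the Markov transition density of the Gibbs sampler satisfies $$k(\mu,\theta,\lambda\mid\mu',\theta',\lambda')\ge\varepsilon_G\,q(\mu,\theta,\lambda)\qquad\text{for all }(\theta',\lambda')\in C_G.$$
   Context: Model. $K$ and $m_1,\ldots,m_K$ are positive integers, $M=\sum_{i=1}^K m_i$, and $y=(y_{ij})$, $1\le i\le K$, $1\le j\le m_i$, is fixed real data. $a_1,b_1,a_2,b_2,s_0$ are known positive constants and $m_0\in\mathbb{R}$ is known. $\mathrm{Gamma}(\alpha,\beta)$ has density proportional to $w^{\alpha-1}e^{-w\beta}I(w>0)$. $\mathrm{N}(\tau,\sigma^2;x)$ denotes the value of the $\mathrm{N}(\tau,\sigma^2)$ density at the point $x$. Hierarchical model: given $\theta=(\theta_1,\ldots,\theta_K)^T$ and $\lambda_e$, the $Y_{ij}$ are independent with $Y_{ij}\sim\mathrm{N}(\theta_i,\lambda_e^{-1})$; given $\mu,\lambda_\theta$, the variables $\theta_1,\ldots,\theta_K,\lambda_e$ are independent with $\theta_i\sim\mathrm{N}(\mu,\lambda_\theta^{-1})$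 and $\lambda_e\sim\mathrm{Gamma}(a_2,b_2)$; $\mu\sim\mathrm{N}(m_0,s_0^{-1})$ and $\lambda_\theta\sim\mathrm{Gamma}(a_1,b_1)$ are independent. Write $\lambda=(\lambda_\theta,\lambda_e)^T$. Notation: $\bar y_i=m_i^{-1}\sum_{j}y_{ij}$, $\bar y=K^{-1}\sum_{i=1}^K\bar y_i$, $\mathrm{SSE}=\sum_{i,j}(y_{ij}-\bar y_i)^2$, $\bar\theta=K^{-1}\sum_{i=1}^K\theta_i$, $v_1(\theta,\mu)=\sum_{i=1}^K(\theta_i-\mu)^2$, $v_2(\theta)=\sum_{i=1}^K m_i(\theta_i-\bar y_i)^2$. Gibbs sampler. The Markov chain on $(\mu,\theta,\lambda)\in\mathbb{R}\times\mathbb{R}^K\times\mathbb{R}_+^2$ whose transition $(\mu',\theta',\lambda')\to(\mu,\theta,\lambda)$ has density $k(\mu,\theta,\lambda\mid\mu',\theta',\lambda')=f(\mu\mid\theta',\lambda',y)\left[\prod_{i=1}^K f(\theta_i\mid\mu,\lambda',y)\right]f(\lambda\mid\mu,\theta,y)$, with $f(\lambda\mid\mu,\theta,y)=f(\lambda_\theta\mid\theta,\mu,y)f(\lambda_e\mid\theta,\mu,y)$, where the $f$'s are the full conditional densities of the posterior given $Y=y$: $\mu\mid\theta,\lambda,y\sim\mathrm{N}\left(\frac{s_0m_0+K\lambda_\theta\bar\theta}{s_0+K\lambda_\theta},\frac1{s_0+K\lambda_\theta}\right)$, $\theta_i\mid\mu,\lambda,y\sim\mathrm{N}\left(\frac{\lambda_\theta\mu+m_i\lambda_e\bar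 y_i}{\lambda_\theta+m_i\lambda_e},\frac1{\lambda_\theta+m_i\lambda_e}\right)$, $\lambda_\theta\mid\theta,\mu,y\sim\mathrm{Gamma}\left(\frac K2+a_1,\frac{v_1(\theta,\mu)}2+b_1\right)$, $\lambda_e\mid\theta,\mu,y\sim\mathrm{Gamma}\left(\frac M2+a_2,\frac{v_2(\theta)+\mathrm{SSE}}2+b_2\right)$. *)

theory Defs
  imports "HOL-Probability.Probability"
begin

text \<open>
  The finite type \<open>'k\<close> indexes the groups, so \<open>K = CARD('k)\<close>. Group \<open>i\<close> has the
  observations \<open>y i j\<close> for \<open>j \<in> {1..m i}\<close>; values of \<open>y i\<close> outside this range are never used.
  The pair \<open>l = (\<lambda>\<^sub>\<theta>, \<lambda>\<^sub>e)\<close> collects the two precisions.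
\<close>

text \<open>The second parameter is the variance; the library's \<^const>\<open>normal_density\<close> takes the
  standard deviation.\<close>

definition N_dens :: "real \<Rightarrow> real \<Rightarrow> real \<Rightarrow> real" where
  "N_dens \<tau> v x = normal_density \<tau> (sqrt v) x"

definition Gamma_dens :: "real \<Rightarrow> real \<Rightarrow> real \<Rightarrow> real" where
  "Gamma_dens \<alpha> \<beta> w =
     (if w > 0 then \<beta> powr \<alpha> / Gamma \<alpha> * w powr (\<alpha> - 1) * exp (- w * \<beta>) else 0)"

definition ybar :: "('k::finite \<Rightarrow> nat) \<Rightarrow> ('k \<Rightarrow> nat \<Rightarrow> real) \<Rightarrow> 'k \<Rightarrow> real" where
  "ybar m y i = (\<Sum>j=1..m i. y i j) / real (m i)"

text \<open>The unweighted mean of the group means, not the mean of all observations.\<close>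

definition ymean :: "('k::finite \<Rightarrow> nat) \<Rightarrow> ('k \<Rightarrow> nat \<Rightarrow> real) \<Rightarrow> real" where
  "ymean m y = (\<Sum>i\<in>UNIV. ybar m y i) / real CARD('k)"

definition SSE :: "('k::finite \<Rightarrow> nat) \<Rightarrow> ('k \<Rightarrow> nat \<Rightarrow> real) \<Rightarrow> real" where
  "SSE m y = (\<Sum>i\<in>UNIV. \<Sum>j=1..m i. (y i j - ybar m y i)\<^sup>2)"

definition tbar :: "real ^ 'k::finite \<Rightarrow> real" where
  "tbar \<theta> = (\<Sum>i\<in>UNIV. \<theta> $ i) / real CARD('k)"

definition v1 :: "real ^ 'k::finite \<Rightarrow> real \<Rightarrow> real" where
  "v1 \<theta> \<mu> = (\<Sum>i\<in>UNIV. (\<theta> $ i - \<mu>)\<^sup>2)"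

definition v2 :: "('k::finite \<Rightarrow> nat) \<Rightarrow> ('k \<Rightarrow> nat \<Rightarrow> real) \<Rightarrow> real ^ 'k \<Rightarrow> real" where
  "v2 m y \<theta> = (\<Sum>i\<in>UNIV. real (m i) * (\<theta> $ i - ybar m y i)\<^sup>2)"

definition mu_mean :: "real \<Rightarrow> real \<Rightarrow> real ^ 'k::finite \<Rightarrow> real \<times> real \<Rightarrow> real" where
  "mu_mean s0 m0 \<theta> l =
     (s0 * m0 + real CARD('k) * fst l * tbar \<theta>) / (s0 + real CARD('k) * fst l)"

section \<open>Full conditional densities\<close>

definition f_mu :: "real \<Rightarrow> real \<Rightarrow> real ^ 'k::finite \<Rightarrow> real \<times> real \<Rightarrow> real \<Rightarrow> real" where
  "f_mu s0 m0 \<theta> l \<mu> = N_dens (mu_mean s0 m0 \<theta> l) (1 / (s0 + real CARD('k) * fst l)) \<mu>"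

text \<open>The last argument of \<open>f_theta\<close> is the value of the single coordinate \<open>\<theta>\<^sub>i\<close>.\<close>

definition f_theta ::
  "('k::finite \<Rightarrow> nat) \<Rightarrow> ('k \<Rightarrow> nat \<Rightarrow> real) \<Rightarrow> 'k \<Rightarrow> real \<Rightarrow> real \<times> real \<Rightarrow> real \<Rightarrow> real" where
  "f_theta m y i \<mu> l t =
     N_dens ((fst l * \<mu> + real (m i) * snd l * ybar m y i) / (fst l + real (m i) * snd l))
            (1 / (fst l + real (m i) * snd l)) t"

definition f_lambda_theta ::
  "real \<Rightarrow> real \<Rightarrow> real \<Rightarrow> real ^ 'k::finite \<Rightarrow> real \<Rightarrow> real" where
  "f_lambda_theta a1 b1 \<mu> \<theta> w = Gamma_dens (real CARD('k) / 2 + a1) (v1 \<theta> \<mu> / 2 + b1) w"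

definition f_lambda_e ::
  "('k::finite \<Rightarrow> nat) \<Rightarrow> ('k \<Rightarrow> nat \<Rightarrow> real) \<Rightarrow> real \<Rightarrow> real \<Rightarrow> real ^ 'k \<Rightarrow> real \<Rightarrow> real" where
  "f_lambda_e m y a2 b2 \<theta> w =
     Gamma_dens (real (\<Sum>i\<in>UNIV. m i) / 2 + a2) ((v2 m y \<theta> + SSE m y) / 2 + b2) w"

definition f_lambda ::
  "('k::finite \<Rightarrow> nat) \<Rightarrow> ('k \<Rightarrow> nat \<Rightarrow> real) \<Rightarrow> real \<Rightarrow> real \<Rightarrow> real \<Rightarrow> real
     \<Rightarrow> real \<Rightarrow> real ^ 'k \<Rightarrow> real \<times> real \<Rightarrow> real" where
  "f_lambda m y a1 b1 a2 b2 \<mu> \<theta> l =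
     f_lambda_theta a1 b1 \<mu> \<theta> (fst l) * f_lambda_e m y a2 b2 \<theta> (snd l)"

section \<open>Transition density of the Gibbs sampler\<close>

text \<open>\<open>gibbs_k \<dots> (\<mu>', \<theta>', l') (\<mu>, \<theta>, l)\<close> is \<open>k(\<mu>, \<theta>, l | \<mu>', \<theta>', l')\<close>: the current state
  comes first.\<close>

definition gibbs_k ::
  "('k::finite \<Rightarrow> nat) \<Rightarrow> ('k \<Rightarrow> nat \<Rightarrow> real) \<Rightarrow> real \<Rightarrow> real \<Rightarrow> real \<Rightarrow> real \<Rightarrow> real \<Rightarrow> real
     \<Rightarrow> real \<times> (real ^ 'k) \<times> real \<times> real \<Rightarrow> real \<times> (real ^ 'k) \<times> real \<times> real \<Rightarrow> real" where
  "gibbs_k m y a1 b1 a2 b2 s0 m0 = (\<lambda>(\<mu>', \<theta>', l') (\<mu>, \<theta>, l).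
     f_mu s0 m0 \<theta>' l' \<mu> * (\<Prod>i\<in>UNIV. f_theta m y i \<mu> l' (\<theta> $ i))
       * f_lambda m y a1 b1 a2 b2 \<mu> \<theta> l)"

section \<open>Small set and minorizing density\<close>

definition C_G1 :: "real \<Rightarrow> real \<Rightarrow> real \<Rightarrow> ((real ^ 'k::finite) \<times> real \<times> real) set" where
  "C_G1 c3 d c4 = {(\<theta>, lt, le). c4 \<le> lt \<and> lt \<le> ln d / c3}"

definition C_G2 :: "real \<Rightarrow> real \<Rightarrow> ((real ^ 'k::finite) \<times> real \<times> real) set" where
  "C_G2 c3 d = {(\<theta>, lt, le). 0 < le \<and> le \<le> ln d / c3}"

definition C_G3 :: "real \<Rightarrow> real \<Rightarrow> real \<Rightarrow> real \<Rightarrow> ((real ^ 'k::finite) \<times> real \<times> real) set" where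
  "C_G3 s0 m0 cl cu = {(\<theta>, l). cl \<le> mu_mean s0 m0 \<theta> l \<and> mu_mean s0 m0 \<theta> l \<le> cu}"

definition g1 ::
  "('k::finite \<Rightarrow> nat) \<Rightarrow> ('k \<Rightarrow> nat \<Rightarrow> real) \<Rightarrow> real \<Rightarrow> real \<Rightarrow> real \<Rightarrow> real \<Rightarrow> real ^ 'k \<Rightarrow> real" where
  "g1 m y c3 d c4 \<mu> \<theta> =
     (c4 / (2 * pi)) powr (real CARD('k) / 2) *
     exp (- (ln d / (2 * c3)) *
            (\<Sum>i\<in>UNIV. (\<theta> $ i - \<mu>)\<^sup>2 + real (m i) * (\<theta> $ i - ybar m y i)\<^sup>2))"

definition g2 ::
  "('k::finite \<Rightarrow> nat) \<Rightarrow> ('k \<Rightarrow> nat \<Rightarrow> real) \<Rightarrow> real \<Rightarrow> real \<Rightarrow> real \<Rightarrow> real \<Rightarrow> real \<Rightarrow> real \<Rightarrow> real" where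
  "g2 m y s0 c3 d cl cu \<mu> =
     N_dens (if \<mu> \<le> ymean m y then cu else cl) (inverse (s0 + real CARD('k) * ln d / c3)) \<mu>"

definition g_mass ::
  "('k::finite \<Rightarrow> nat) \<Rightarrow> ('k \<Rightarrow> nat \<Rightarrow> real) \<Rightarrow> real \<Rightarrow> real \<Rightarrow> real \<Rightarrow> real \<Rightarrow> real \<Rightarrow> real \<Rightarrow> real" where
  "g_mass m y s0 c3 d c4 cl cu =
     (LINT \<mu>|lborel. LINT \<theta>|lborel. g1 m y c3 d c4 \<mu> \<theta> * g2 m y s0 c3 d cl cu \<mu>)"

definition q_dens ::
  "('k::finite \<Rightarrow> nat) \<Rightarrow> ('k \<Rightarrow> nat \<Rightarrow> real) \<Rightarrow> real \<Rightarrow> real \<Rightarrow> real \<Rightarrow> real \<Rightarrow> real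
     \<Rightarrow> real \<Rightarrow> real \<Rightarrow> real \<Rightarrow> real \<Rightarrow> real \<Rightarrow> real \<times> (real ^ 'k) \<times> real \<times> real \<Rightarrow> real" where
  "q_dens m y a1 b1 a2 b2 s0 c3 d c4 cl cu = (\<lambda>(\<mu>, \<theta>, l).
     g1 m y c3 d c4 \<mu> \<theta> * g2 m y s0 c3 d cl cu \<mu> / g_mass m y s0 c3 d c4 cl cu
       * f_lambda m y a1 b1 a2 b2 \<mu> \<theta> l)"

end

(* With L = ln d / c3, membership in C_G confines the precisions of the full conditionals of mu and
   theta_i to [s0 + K c4, s0 + K L] and [c4, L + m_i L]. The smaller end bounds the normalizing
   constant, the larger one the exponent. The conditional mean of mu lies in [cl, cu], an interval
   centred at the grand mean, so its distance to mu is at most the distance from mu to the endpoint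
   on the other side of the centre. The factor f(lambda | mu, theta, y) is common to both sides. *)
theory Submission
  imports Defs
begin

text \<open>In terms of the precision \<open>p\<close>, the normalizing constant increases and the
  exponential factor decreases, so the two can be bounded separately.\<close>

lemma N_dens_precision:
  assumes "p > 0"
  shows "N_dens a (1 / p) x = sqrt (p / (2 * pi)) * exp (- (p * (x - a)\<^sup>2 / 2))"
  using assms by (simp add: N_dens_def normal_density_def real_sqrt_divide power_divide field_simps)

text \<open>\<open>E\<close> stays free because the quadratic form is bounded differently for
  \<open>f_mu\<close> (far endpoint) and for \<open>f_theta\<close> (weighted sum of
  squares).\<close>

lemma N_dens_lower_bound:
  assumes "0 < q" "q \<le> p" "p * (x - a)\<^sup>2 \<le> E"
  shows "sqrt (q / (2 * pi)) * exp (- (E / 2)) \<le> N_dens a (1 / p) x"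
  unfolding N_dens_precision[OF less_le_trans[OF assms(1,2)]]
  using assms by (intro mult_mono) (auto simp: divide_right_mono)

lemma N_dens_nonneg: "0 \<le> N_dens a v x"
  by (simp add: N_dens_def)

text \<open>The sign is decided by the shape: \<open>powr\<close> is nonnegative at every rate, and
  \<open>Gamma\<close> is positive at a positive shape.\<close>

lemma Gamma_dens_nonneg: "\<alpha> > 0 \<Longrightarrow> 0 \<le> Gamma_dens \<alpha> \<beta> w"
  by (simp add: Gamma_dens_def less_imp_le)

lemma f_lambda_nonneg:
  assumes "a1 > 0" "a2 > 0"
  shows "0 \<le> f_lambda m y a1 b1 a2 b2 \<mu> \<theta> l"
  unfolding f_lambda_def f_lambda_theta_def f_lambda_e_def
  using assms by (intro mult_nonneg_nonneg Gamma_dens_nonneg add_nonneg_pos)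
    (auto simp: sum_nonneg)

text \<open>Completing the square: the two sides differ by a nonnegative term free of
  \<open>x\<close>. The bound is linear in \<open>u\<close> and \<open>v\<close>, so each precision
  can then be enlarged on its own.\<close>

lemma weighted_mean_deviation_le:
  fixes u v s t x :: real
  assumes "0 < u" "0 \<le> v"
  shows "(u + v) * (x - (u * s + v * t) / (u + v))\<^sup>2 \<le> u * (x - s)\<^sup>2 + v * (x - t)\<^sup>2"
proof -
  have "u * (x - s)\<^sup>2 + v * (x - t)\<^sup>2 - (u + v) * (x - (u * s + v * t) / (u + v))\<^sup>2
      = u * v * (s - t)\<^sup>2 / (u + v)"
    using assms by (simp add: divide_simps) (simp add: power2_eq_square algebra_simps)
  moreover have "0 \<le> u * v * (s - t)\<^sup>2 / (u + v)"
    using assms by simp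
  ultimately show ?thesis by linarith
qed

text \<open>For \<open>x \<le> c\<close>, both \<open>a - x\<close> and \<open>x - a\<close> are at
  most \<open>c + r - x\<close>, the latter because \<open>x - c \<le> c - x\<close>. The other case
  is the mirror image.\<close>

lemma dist_far_endpoint:
  fixes x a c r :: real
  assumes "c - r \<le> a" "a \<le> c + r"
  shows "(x - a)\<^sup>2 \<le> (x - (if x \<le> c then c + r else c - r))\<^sup>2"
  using assms by (intro abs_le_square_iff[THEN iffD1]) auto

lemma f_mu_lower_bound:
  fixes \<theta> :: "real ^ 'k::finite" and m :: "'k \<Rightarrow> nat"
  assumes "0 < s0" "0 < c4" "c4 \<le> fst l" "fst l \<le> ln d / c3"
    and "ymean m y - r \<le> mu_mean s0 m0 \<theta> l" "mu_mean s0 m0 \<theta> l \<le> ymean m y + r"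
  shows "sqrt ((s0 + real CARD('k) * c4) / (s0 + real CARD('k) * ln d / c3))
           * g2 m y s0 c3 d (ymean m y - r) (ymean m y + r) \<mu> \<le> f_mu s0 m0 \<theta> l \<mu>"
proof -
  define P where "P = s0 + real CARD('k) * ln d / c3"
  define q where "q = s0 + real CARD('k) * c4"
  define p where "p = s0 + real CARD('k) * fst l"
  define e where "e = (if \<mu> \<le> ymean m y then ymean m y + r else ymean m y - r)"
  have q: "0 < q" "q \<le> p"
    using assms by (simp_all add: p_def q_def add_pos_nonneg)
  have "p \<le> P"
    using mult_left_mono[OF assms(4), of "real CARD('k)"] by (simp add: p_def P_def)
  with q have P: "0 < P" by linarith
  have "p * (\<mu> - mu_mean s0 m0 \<theta> l)\<^sup>2 \<le> P * (\<mu> - e)\<^sup>2"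
    unfolding e_def using \<open>p \<le> P\<close> P dist_far_endpoint[OF assms(5,6)]
    by (intro mult_mono) auto
  then have "sqrt (q / (2 * pi)) * exp (- (P * (\<mu> - e)\<^sup>2 / 2)) \<le> f_mu s0 m0 \<theta> l \<mu>"
    unfolding f_mu_def p_def[symmetric] by (rule N_dens_lower_bound[OF q])
  moreover have "g2 m y s0 c3 d (ymean m y - r) (ymean m y + r) \<mu> = N_dens e (1 / P) \<mu>"
    by (simp add: g2_def e_def P_def inverse_eq_divide)
  \<comment> \<open>The density \<open>g2\<close> carries the constant
    \<open>sqrt (P / (2 * pi))\<close>; the factor \<open>sqrt (q / P)\<close> exchanges it for
    \<open>sqrt (q / (2 * pi))\<close>.\<close>
  ultimately show ?thesis
    unfolding P_def[symmetric] q_def[symmetric]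
    using P by (simp add: N_dens_precision real_sqrt_divide)
qed

lemma f_theta_lower_bound:
  assumes "0 < c4" "c4 \<le> fst l" "fst l \<le> L" "0 < snd l" "snd l \<le> L"
  shows "sqrt (c4 / (2 * pi)) * exp (- (L * ((t - \<mu>)\<^sup>2 + real (m i) * (t - ybar m y i)\<^sup>2) / 2))
           \<le> f_theta m y i \<mu> l t"
  unfolding f_theta_def
proof (rule N_dens_lower_bound)
  \<comment> \<open>The small set gives \<open>snd l\<close> no positive lower bound, so the bound
    comes from \<open>fst l\<close> alone.\<close>
  show "c4 \<le> fst l + real (m i) * snd l"
    using assms by (simp add: add_increasing2)
  have "(fst l + real (m i) * snd l)
        * (t - (fst l * \<mu> + real (m i) * snd l * ybar m y i) / (fst l + real (m i) * snd l))\<^sup>2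
      \<le> fst l * (t - \<mu>)\<^sup>2 + real (m i) * snd l * (t - ybar m y i)\<^sup>2"
    using assms by (intro weighted_mean_deviation_le) auto
  also have "\<dots> \<le> L * (t - \<mu>)\<^sup>2 + real (m i) * L * (t - ybar m y i)\<^sup>2"
    using assms by (intro add_mono mult_right_mono mult_left_mono) auto
  finally show "(fst l + real (m i) * snd l)
        * (t - (fst l * \<mu> + real (m i) * snd l * ybar m y i) / (fst l + real (m i) * snd l))\<^sup>2
      \<le> L * ((t - \<mu>)\<^sup>2 + real (m i) * (t - ybar m y i)\<^sup>2)"
    by (simp add: algebra_simps)
qed fact

text \<open>Distributing the power and the exponential of the sum over the coordinates gives exactly
  the bounds of \<open>f_theta_lower_bound\<close> with \<open>L = ln d / c3\<close>.\<close>

lemma g1_eq_prod: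
  fixes \<theta> :: "real ^ 'k::finite"
  assumes "0 < c4"
  shows "g1 m y c3 d c4 \<mu> \<theta> = (\<Prod>i\<in>UNIV. sqrt (c4 / (2 * pi))
    * exp (- (ln d / c3 * ((\<theta> $ i - \<mu>)\<^sup>2 + real (m i) * (\<theta> $ i - ybar m y i)\<^sup>2) / 2)))"
proof -
  have "(c4 / (2 * pi)) powr (real CARD('k) / 2) = sqrt (c4 / (2 * pi)) ^ CARD('k)"
    using assms by (simp add: powr_half_sqrt[symmetric] powr_realpow[symmetric] powr_powr)
  moreover have "- (ln d / (2 * c3)) * (\<Sum>i\<in>UNIV. (\<theta> $ i - \<mu>)\<^sup>2 + real (m i) * (\<theta> $ i - ybar m y i)\<^sup>2)
      = (\<Sum>i\<in>UNIV. - (ln d / c3 * ((\<theta> $ i - \<mu>)\<^sup>2 + real (m i) * (\<theta> $ i - ybar m y i)\<^sup>2) / 2))"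
    unfolding sum_distrib_left by (intro sum.cong) (simp_all add: divide_simps)
  ultimately show ?thesis
    by (simp only: g1_def prod.distrib prod_constant exp_sum finite_class.finite_UNIV)
qed

lemma prod_f_theta_lower_bound:
  fixes \<theta> :: "real ^ 'k::finite"
  assumes "0 < c4" "c4 \<le> fst l" "fst l \<le> ln d / c3" "0 < snd l" "snd l \<le> ln d / c3"
  shows "g1 m y c3 d c4 \<mu> \<theta> \<le> (\<Prod>i\<in>UNIV. f_theta m y i \<mu> l (\<theta> $ i))"
  unfolding g1_eq_prod[OF assms(1)]
  using assms by (intro prod_mono conjI f_theta_lower_bound) auto

theorem proposition5p2:
  fixes m :: "'k::finite \<Rightarrow> nat"
    and y :: "'k \<Rightarrow> nat \<Rightarrow> real"
    and a1 b1 a2 b2 s0 m0 c3 d \<delta>1 \<delta>7 c4 cl cu \<epsilon>G :: real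
    and CG :: "((real ^ 'k) \<times> real \<times> real) set"
  assumes "CARD('k) \<ge> 3"
    and "\<And>i. m i \<ge> 2"
    and "b1 > 0" and "a2 > 0" and "b2 > 0" and "s0 > 0"
    and "a1 > 3 / 2"
    and "0 < c3" and "c3 < min b1 b2"
    and "\<delta>1 = 1 / (2 * a1 + real CARD('k) - 2)"
    and "\<delta>7 = 1 / (2 * (a1 - 1))"
    and "d > 0" and "d * ln d > c3 * \<delta>7 / (real CARD('k) * \<delta>1)"
    and "c4 = \<delta>7 / (real CARD('k) * \<delta>1 * d)"
    and "cl = ymean m y - sqrt ((m0 - ymean m y)\<^sup>2 + d)"
    and "cu = ymean m y + sqrt ((m0 - ymean m y)\<^sup>2 + d)"
    and "CG = C_G1 c3 d c4 \<inter> C_G2 c3 d \<inter> C_G3 s0 m0 cl cu"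
    and "\<epsilon>G = sqrt ((s0 + real CARD('k) * c4) / (s0 + real CARD('k) * ln d / c3))
               * g_mass m y s0 c3 d c4 cl cu"
  shows "\<forall>(\<theta>', l') \<in> CG. \<forall>\<mu>'. \<forall>\<mu> \<theta>. \<forall>l \<in> {0<..} \<times> {0<..}.
           gibbs_k m y a1 b1 a2 b2 s0 m0 (\<mu>', \<theta>', l') (\<mu>, \<theta>, l)
             \<ge> \<epsilon>G * q_dens m y a1 b1 a2 b2 s0 c3 d c4 cl cu (\<mu>, \<theta>, l)"
proof (clarify, goal_cases)
  case (1 \<theta>' lt le \<mu>' \<mu> \<theta> w v)
  define r where "r = sqrt ((m0 - ymean m y)\<^sup>2 + d)"
  define \<rho> where "\<rho> = sqrt ((s0 + real CARD('k) * c4) / (s0 + real CARD('k) * ln d / c3))"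
  define F where "F = f_lambda m y a1 b1 a2 b2 \<mu> \<theta> (w, v)"
  define G1 where "G1 = g1 m y c3 d c4 \<mu> \<theta>"
  define G2 where "G2 = g2 m y s0 c3 d cl cu \<mu>"
  \<comment> \<open>\<open>r\<close> is the half-width that makes \<open>cl\<close> and
    \<open>cu\<close> symmetric about \<open>ymean m y\<close>, as \<open>f_mu_lower_bound\<close>
    requires.\<close>
  note c = assms(15,16)[folded r_def]
  \<comment> \<open>Since \<open>a1 > 3 / 2\<close>, the denominators of \<delta>1 and \<delta>7 are
    positive.\<close>
  have c4: "0 < c4"
    using assms(1,7,10,11,12,14) by simp
  have l: "c4 \<le> lt" "lt \<le> ln d / c3" "0 < le" "le \<le> ln d / c3"
      "cl \<le> mu_mean s0 m0 \<theta>' (lt, le)" "mu_mean s0 m0 \<theta>' (lt, le) \<le> cu"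
    using 1(1) assms(17) by (auto simp: C_G1_def C_G2_def C_G3_def)
  have mu: "\<rho> * G2 \<le> f_mu s0 m0 \<theta>' (lt, le) \<mu>"
    unfolding \<rho>_def G2_def c using l assms(6) c4 by (intro f_mu_lower_bound) (auto simp: c)
  have theta: "G1 \<le> (\<Prod>i\<in>UNIV. f_theta m y i \<mu> (lt, le) (\<theta> $ i))"
    unfolding G1_def using l c4 by (intro prod_f_theta_lower_bound) auto
  have F: "0 \<le> F"
    unfolding F_def using assms(4,7) by (intro f_lambda_nonneg) auto
  have nonneg: "0 \<le> G1" "0 \<le> f_mu s0 m0 \<theta>' (lt, le) \<mu>"
    by (simp_all add: G1_def g1_def f_mu_def N_dens_nonneg)
  have product: "\<rho> * G2 * G1 * F
      \<le> f_mu s0 m0 \<theta>' (lt, le) \<mu> * (\<Prod>i\<in>UNIV. f_theta m y i \<mu> (lt, le) (\<theta> $ i)) * F"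
    using mult_mono[OF mu theta nonneg(2,1)] F by (rule mult_right_mono)
  \<comment> \<open>A zero mass would make the left-hand side 0; otherwise the mass cancels.\<close>
  have "\<epsilon>G * q_dens m y a1 b1 a2 b2 s0 c3 d c4 cl cu (\<mu>, \<theta>, w, v)
      = (if g_mass m y s0 c3 d c4 cl cu = 0 then 0 else \<rho> * G2 * G1 * F)"
    by (simp add: assms(18) q_dens_def \<rho>_def F_def G1_def G2_def)
  also have "\<dots> \<le> f_mu s0 m0 \<theta>' (lt, le) \<mu> * (\<Prod>i\<in>UNIV. f_theta m y i \<mu> (lt, le) (\<theta> $ i)) * F"
    using product nonneg(2) F
    by (auto simp: f_theta_def intro!: mult_nonneg_nonneg prod_nonneg N_dens_nonneg)
  finally show ?case
    by (simp add: gibbs_k_def F_def)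
qed

end
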